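(* Let $\bm{x}=(x_n)_{n\in\omega}$ be a sequence taking values in a topological space $(X,\tau)$, let $\mathcal{I}$ be an ideal on $\omega$, and let $\mathscr{F}=\{F_\eta:\eta\in X\}$ be a rough family such that every $F_\eta$ is closed. Suppose that the map $X\to\mathcal{H}(X)$, $\eta\mapsto F_\eta$, is $\widehat{\tau}$-continuous (that is, continuous from $(X,\tau)$ to $(\mathcal{H}(X),\widehat{\tau})$). Then $\mathsf{L}_{\bm{x}}(\mathcal{I},\mathscr{F})$ is closed.
   Context: $\omega$ denotes the set of nonnegative integers. An ideal on $\omega$ is a family $\mathcal{I}\subseteq\mathcal{P}(\omega)$ closed under subsets and finite unions, containing all finite subsets of $\omega$, and with $\omega\notin\mathcal{I}$. Topological spaces are not assumed to be Hausdorff. A rough family on a topological space $X$ is a collection $\mathscr{F}=\{F_\eta:\eta\in X\}$ of subsets of $X$ such that $\eta\in F_\eta$ for all $\eta\in X$. A sequence $(x_n)_{n\in\omega}$ in $X$ is $\mathcal{I}$-convergent to $\eta\in X$ with roughness $\mathscr{F}$, written $(\mathcal{I},\mathscr{F})\text{-}\lim_n x_n=\eta$, if $\{n\in\omega: x_n\notin U\}\in\mathcal{I}$ for all open sets $U\subseteq X$ with $F_\eta\subseteq U$. The set of all such limits is $\mathsf{L}_{\bm{x}}(\mathcal{I},\mathscr{F}):=\{\eta\in X:(\mathcal{I},\mathscr{F})\text{-}\lim_n x_n=\eta\}$. The hyperspace $\mathcal{H}(X):=\{F\subseteq X: F\text{ nonempty closed}\}$ is endowed with the upper Vietoris topology $\widehat{\tau}$,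 that is, the topology generated by the base of sets $\{F\in\mathcal{H}(X):F\subseteq U\}$, with $U\in\tau$. *)

theory Defs
  imports "HOL-Analysis.Analysis"
begin

definition ideal_on_nat :: "nat set set \<Rightarrow> bool" where
  "ideal_on_nat I \<longleftrightarrow>
     (\<forall>A\<in>I. \<forall>B. B \<subseteq> A \<longrightarrow> B \<in> I) \<and>
     (\<forall>A\<in>I. \<forall>B\<in>I. A \<union> B \<in> I) \<and>
     (\<forall>A. finite A \<longrightarrow> A \<in> I) \<and>
     UNIV \<notin> I"

(* Only the values of F on the points of X matter. *)
definition rough_family :: "'a topology \<Rightarrow> ('a \<Rightarrow> 'a set) \<Rightarrow> bool" where
  "rough_family X F \<longleftrightarrow> (\<forall>\<eta>\<in>topspace X. F \<eta> \<subseteq> topspace X \<and> \<eta> \<in> F \<eta>)"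

definition rough_converges ::
    "'a topology \<Rightarrow> nat set set \<Rightarrow> ('a \<Rightarrow> 'a set) \<Rightarrow> (nat \<Rightarrow> 'a) \<Rightarrow> 'a \<Rightarrow> bool" where
  "rough_converges X I F x \<eta> \<longleftrightarrow>
     (\<forall>U. openin X U \<and> F \<eta> \<subseteq> U \<longrightarrow> {n. x n \<notin> U} \<in> I)"

definition rough_limits ::
    "'a topology \<Rightarrow> nat set set \<Rightarrow> ('a \<Rightarrow> 'a set) \<Rightarrow> (nat \<Rightarrow> 'a) \<Rightarrow> 'a set" where
  "rough_limits X I F x = {\<eta> \<in> topspace X. rough_converges X I F x \<eta>}"

definition hyperspace :: "'a topology \<Rightarrow> 'a set set" where
  "hyperspace X = {F. closedin X F \<and> F \<noteq> {}}"

(* topology_generated_by takes its argument as a subbase; upper_vietoris_base below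
   shows that the generating family is in fact a base, and topspace_upper_vietoris
   that the underlying set is the hyperspace. *)
definition upper_vietoris :: "'a topology \<Rightarrow> 'a set topology" where
  "upper_vietoris X =
     topology_generated_by {{F \<in> hyperspace X. F \<subseteq> U} | U. openin X U}"

lemma topspace_upper_vietoris: "topspace (upper_vietoris X) = hyperspace X"
proof -
  have "F \<subseteq> topspace X" if "F \<in> hyperspace X" for F
    using that by (simp add: hyperspace_def closedin_subset)
  then show ?thesis
    unfolding upper_vietoris_def topology_generated_by_topspace
    using openin_topspace[of X] by blast
qed

lemma upper_vietoris_base:
  "openin (upper_vietoris X) W \<longleftrightarrow>
     (\<exists>\<U>. (\<forall>U\<in>\<U>. openin X U) \<and> W = (\<Union>U\<in>\<U>. {F \<in> hyperspace X. F \<subseteq> U}))"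
proof
  let ?B = "\<lambda>U. {F \<in> hyperspace X. F \<subseteq> U}"
  assume "openin (upper_vietoris X) W"
  then have "generate_topology_on {?B U | U. openin X U} W"
    by (simp add: upper_vietoris_def openin_topology_generated_by_iff)
  then have *: "\<exists>U. openin X U \<and> F \<in> ?B U \<and> ?B U \<subseteq> W" if "F \<in> W" for F
    using that
  proof (induction arbitrary: F)
    case Empty
    then show ?case by simp
  next
    case (Int A B)
    then obtain U V where "openin X U" "F \<in> ?B U" "?B U \<subseteq> A"
      and "openin X V" "F \<in> ?B V" "?B V \<subseteq> B"
      by (meson IntD1 IntD2)
    then have "openin X (U \<inter> V) \<and> F \<in> ?B (U \<inter> V) \<and> ?B (U \<inter> V) \<subseteq> A \<inter> B"
      by (simp add: openin_Int) blast
    then show ?case by (rule exI)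
  next
    case (UN K)
    then obtain k where k: "k \<in> K" "F \<in> k" by (meson UnionE)
    with UN.IH obtain U where "openin X U" "F \<in> ?B U" "?B U \<subseteq> k" by meson
    with k show ?case by (meson Union_upper order_trans)
  next
    case (Basis s)
    then obtain U where "openin X U" "s = ?B U" by auto
    with Basis.prems show ?case by (intro exI[of _ U]) simp
  qed
  have "W = (\<Union>U\<in>{U. openin X U \<and> ?B U \<subseteq> W}. ?B U)"
  proof (rule equalityI)
    show "W \<subseteq> (\<Union>U\<in>{U. openin X U \<and> ?B U \<subseteq> W}. ?B U)"
    proof
      fix F assume "F \<in> W"
      from *[OF this] obtain U where U: "openin X U \<and> ?B U \<subseteq> W" "F \<in> ?B U" by meson
      show "F \<in> (\<Union>U\<in>{U. openin X U \<and> ?B U \<subseteq> W}. ?B U)"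
        by (rule UN_I[of U]) (rule CollectI, rule U(1), rule U(2))
    qed
    show "(\<Union>U\<in>{U. openin X U \<and> ?B U \<subseteq> W}. ?B U) \<subseteq> W"
      by (rule UN_least) simp
  qed
  moreover have "\<forall>U\<in>{U. openin X U \<and> ?B U \<subseteq> W}. openin X U" by simp
  ultimately show "\<exists>\<U>. (\<forall>U\<in>\<U>. openin X U) \<and> W = (\<Union>U\<in>\<U>. ?B U)" by (intro exI conjI)
next
  assume "\<exists>\<U>. (\<forall>U\<in>\<U>. openin X U) \<and> W = (\<Union>U\<in>\<U>. {F \<in> hyperspace X. F \<subseteq> U})"
  then obtain \<U> where \<U>: "\<forall>U\<in>\<U>. openin X U"
    and W: "W = (\<Union>U\<in>\<U>. {F \<in> hyperspace X. F \<subseteq> U})" by (elim exE conjE)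
  have "openin (upper_vietoris X) {F \<in> hyperspace X. F \<subseteq> U}" if "openin X U" for U
    unfolding upper_vietoris_def
    by (rule topology_generated_by_Basis, rule CollectI, rule exI[of _ U]) (simp add: that)
  with \<U> show "openin (upper_vietoris X) W"
    unfolding W by (intro openin_Union) (simp add: image_iff, metis)
qed

end

theory Submission
  imports Defs
begin

text \<open>A point \<open>\<eta>\<close> fails to be a rough limit exactly when some open
  \<open>U\<close> containing \<open>F \<eta>\<close> has \<open>{n. x n \<notin> U}\<close> outside
  \<open>I\<close>. The same \<open>U\<close> then witnesses failure at every point whose
  \<open>F\<close>-value lies inside \<open>U\<close>, and these points form an open set by
  continuity (\<open>openin_preimage_upper_vietoris\<close>). So the non-limits are a union of open
  sets.\<close>

lemma openin_upper_vietoris_basic: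
  assumes "openin X U"
  shows "openin (upper_vietoris X) {A \<in> hyperspace X. A \<subseteq> U}"
  unfolding upper_vietoris_base using assms by (intro exI[of _ "{U}"]) simp

lemma openin_preimage_upper_vietoris:
  assumes cont: "continuous_map X (upper_vietoris Y) F" and U: "openin Y U"
  shows "openin X {\<eta> \<in> topspace X. F \<eta> \<subseteq> U}"
proof -
  \<comment> \<open>Continuity already forces the values of \<open>F\<close> into the hyperspace, so
    the set in question is the full preimage of a basic open set.\<close>
  have "F \<eta> \<in> hyperspace Y" if "\<eta> \<in> topspace X" for \<eta>
    using continuous_map_image_subset_topspace[OF cont] that
    by (auto simp: topspace_upper_vietoris)
  then have "{\<eta> \<in> topspace X. F \<eta> \<subseteq> U} =
      {\<eta> \<in> topspace X. F \<eta> \<in> {A \<in> hyperspace Y. A \<subseteq> U}}"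
    by auto
  then show ?thesis
    using openin_continuous_map_preimage[OF cont openin_upper_vietoris_basic[OF U]] by simp
qed

theorem theorem1p6:
  fixes X :: "'a topology"
    and x :: "nat \<Rightarrow> 'a"
    and I :: "nat set set"
    and F :: "'a \<Rightarrow> 'a set"
  assumes "\<forall>n. x n \<in> topspace X"
    and "ideal_on_nat I"
    and "rough_family X F"
    and "\<forall>\<eta>\<in>topspace X. closedin X (F \<eta>)"
    and "continuous_map X (upper_vietoris X) F"
  shows "closedin X (rough_limits X I F x)"
proof -
  \<comment> \<open>Badness of \<open>U\<close> depends only on \<open>x\<close> and
    \<open>I\<close>, not on \<open>\<eta>\<close>, so one family of open sets serves all
    non-limits.\<close>
  let ?bad = "{U. openin X U \<and> {n. x n \<notin> U} \<notin> I}"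
  have "topspace X - rough_limits X I F x =
      (\<Union>U\<in>?bad. {\<eta> \<in> topspace X. F \<eta> \<subseteq> U})"
    by (auto simp: rough_limits_def rough_converges_def)
  moreover have "openin X (\<Union>U\<in>?bad. {\<eta> \<in> topspace X. F \<eta> \<subseteq> U})"
    using openin_preimage_upper_vietoris[OF assms(5)] by blast
  ultimately show ?thesis
    by (auto simp: closedin_def rough_limits_def)
qed

end
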